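(* Let $X$ be a topological space and let $Y$ be a convex set in a topological vector space. Let $T\in KKM(Y,X)$ be compact. Let $P:X\to 2^{Y}$ be a correspondence such that $X=\bigcup_{y\in Y}\operatorname{Int}P^{-1}(y)$. Then there exist an integer $n\ge 2$, points $y_1^{\ast},\dots,y_n^{\ast}\in Y$, a point $y^{\ast}\in\operatorname{co}\{y_1^{\ast},\dots,y_n^{\ast}\}$ and $x^{\ast}\in T(y^{\ast})$ such that $y_i^{\ast}\in P(x^{\ast})$ for each $i\in\{1,\dots,n\}$.
   Context: A correspondence $T:Y\to 2^{X}$ assigns to each $y\in Y$ a subset $T(y)\subset X$; $T(B)=\bigcup_{y\in B}T(y)$ for $B\subset Y$. $T$ is compact if $\overline{T(Y)}$ is a compact subset of $X$. For $P:X\to 2^{Y}$, $P^{-1}(y)=\{x\in X:y\in P(x)\}$. $\operatorname{co}$ denotes the convex hull. Given $T,H:Y\to 2^{X}$, $H$ is a generalized KKM mapping w.r.t. $T$ if $T(\operatorname{co}B)\subset H(B)$ for each finite $B\subset Y$. $KKM(Y,X)$ is the set of $T:Y\to 2^{X}$ having the KKM property: for every $H:Y\to 2^{X}$ which is a generalized KKM mapping w.r.t. $T$, the family $\{\overline{H(y)}:y\in Y\}$ has the finite intersection property. *)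

theory Defs
  imports "HOL-Analysis.Analysis"
begin

text \<open>
  Real topological vector spaces; no separation axiom is assumed. The filter form of joint
  continuity of scalar multiplication follows the library's treatment of addition in
  \<^class>\<open>topological_monoid_add\<close>.
\<close>

class topological_real_vector = real_vector + topological_ab_group_add +
  assumes tendsto_scaleR_Pair:
    "LIM p (nhds r \<times>\<^sub>F nhds x). fst p *\<^sub>R snd p :> nhds (r *\<^sub>R x)"

text \<open>
  A correspondence from \<open>A\<close> to \<open>B\<close> is a set-valued function whose values on \<open>A\<close> are subsets
  of \<open>B\<close>; empty values are allowed, and its values outside \<open>A\<close> are irrelevant.
\<close>

definition correspondence :: "'a set \<Rightarrow> 'b set \<Rightarrow> ('a \<Rightarrow> 'b set) \<Rightarrow> bool" where
  "correspondence A B F \<longleftrightarrow> (\<forall>a\<in>A. F a \<subseteq> B)"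

definition corr_image :: "('a \<Rightarrow> 'b set) \<Rightarrow> 'a set \<Rightarrow> 'b set" where
  "corr_image F B = (\<Union>b\<in>B. F b)"

definition lower_inverse :: "'a set \<Rightarrow> ('a \<Rightarrow> 'b set) \<Rightarrow> 'b \<Rightarrow> 'a set" where
  "lower_inverse A P b = {a\<in>A. b \<in> P a}"

definition compact_correspondence :: "'y set \<Rightarrow> 'x topology \<Rightarrow> ('y \<Rightarrow> 'x set) \<Rightarrow> bool" where
  "compact_correspondence Y X T \<longleftrightarrow> compactin X (X closure_of corr_image T Y)"

definition finite_intersection_property :: "'a set set \<Rightarrow> bool" where
  "finite_intersection_property \<A> \<longleftrightarrow>
     (\<forall>\<F>\<subseteq>\<A>. finite \<F> \<and> \<F> \<noteq> {} \<longrightarrow> \<Inter>\<F> \<noteq> {})"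

definition generalized_KKM ::
  "'y::real_vector set \<Rightarrow> ('y \<Rightarrow> 'x set) \<Rightarrow> ('y \<Rightarrow> 'x set) \<Rightarrow> bool" where
  "generalized_KKM Y T H \<longleftrightarrow>
     (\<forall>B. finite B \<and> B \<subseteq> Y \<longrightarrow> corr_image T (convex hull B) \<subseteq> corr_image H B)"

definition KKM :: "'y::real_vector set \<Rightarrow> 'x topology \<Rightarrow> ('y \<Rightarrow> 'x set) set" where
  "KKM Y X =
     {T. correspondence Y (topspace X) T \<and>
         (\<forall>H. correspondence Y (topspace X) H \<and> generalized_KKM Y T H \<longrightarrow>
              finite_intersection_property ((\<lambda>y. X closure_of H y) ` Y))}"

end

theory Submission
  imports Defs
begin

text \<open>
  Let \<open>K\<close> be the compact closure of \<open>T(Y)\<close> and let \<open>H(y)\<close> be what remains of \<open>K\<close> after removing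
  the interior of \<open>P\<^sup>-\<^sup>1(y)\<close>. These interiors cover \<open>K\<close>, so finitely many of them already do, and
  then finitely many of the closed sets \<open>H(y)\<close> have no common point. The KKM property of \<open>T\<close>
  therefore forbids \<open>H\<close> to be a generalized KKM mapping with respect to \<open>T\<close>: some finite \<open>B\<close> has
  a point \<open>x \<in> T(y)\<close>, with \<open>y\<close> in the convex hull of \<open>B\<close>, that avoids \<open>H(b)\<close> for every \<open>b \<in> B\<close>.
  Since \<open>Y\<close> is convex, \<open>x\<close> lies in \<open>K\<close>, so avoiding \<open>H(b)\<close> means lying in the interior of
  \<open>P\<^sup>-\<^sup>1(b)\<close>, and all of \<open>B\<close> is contained in \<open>P(x)\<close>. It remains to list the elements of \<open>B\<close>,
  where repetitions make the list as long as required.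
\<close>

text \<open>
  One superfluous repetition suffices to give a singleton an enumeration of length two.
\<close>

lemma finite_nonempty_enumeration_ge_2:
  assumes "finite B" "B \<noteq> {}"
  obtains n :: nat and ys where "n \<ge> 2" "ys ` {1..n} = B"
proof -
  obtain f where f: "bij_betw f {1..card B} B"
    using assms(1) ex_bij_betw_nat_finite_1 by blast
  have pos: "card B \<ge> 1"
    using assms by (simp add: Suc_le_eq card_gt_0_iff)
  define ys where "ys = f(Suc (card B) := f 1)"
  have "ys ` {1..card B} = f ` {1..card B}"
    by (rule image_cong) (auto simp: ys_def)
  moreover have "{1..Suc (card B)} = insert (Suc (card B)) {1..card B}"
    by auto
  moreover have "ys (Suc (card B)) = f 1"
    by (simp add: ys_def)
  ultimately have "ys ` {1..Suc (card B)} = insert (f 1) (f ` {1..card B})"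
    by (simp only: image_insert)
  also have "\<dots> = f ` {1..card B}"
    using pos by auto
  also have "\<dots> = B"
    using f by (simp add: bij_betw_def)
  finally have "ys ` {1..Suc (card B)} = B" .
  then show thesis
    using that[of "Suc (card B)" ys] pos by simp
qed

text \<open>
  Here compactness meets the KKM property. A finite subcover says that finitely many of the
  closed complements \<open>K - U(y)\<close>, where \<open>K\<close> is the compact closure of \<open>T(Y)\<close>, have empty
  intersection, so \<open>y \<mapsto> K - U(y)\<close> is not a generalized KKM mapping with respect to \<open>T\<close>; the
  conclusion unfolds this failure.
\<close>

lemma KKM_open_cover:
  assumes "T \<in> KKM Y X"
    and "compact_correspondence Y X T"
    and "Y \<noteq> {}"
    and open_U: "\<And>y. y \<in> Y \<Longrightarrow> openin X (U y)"
    and cover: "X closure_of corr_image T Y \<subseteq> (\<Union>y\<in>Y. U y)"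
  obtains B y x where "finite B" "B \<subseteq> Y" "y \<in> convex hull B" "x \<in> T y"
    "\<And>b. b \<in> B \<Longrightarrow> x \<notin> X closure_of corr_image T Y - U b"
proof -
  define K where "K = X closure_of corr_image T Y"
  define H where "H = (\<lambda>y. K - U y)"
  have "compactin X K"
    using assms(2) by (simp add: compact_correspondence_def K_def)
  then obtain \<F> where "finite \<F>" "\<F> \<subseteq> U ` Y" "K \<subseteq> \<Union>\<F>"
    using open_U cover unfolding K_def[symmetric] compactin_def by (metis imageE)
  then obtain F where F: "finite F" "F \<subseteq> Y" "K \<subseteq> (\<Union>y\<in>F. U y)"
    by (metis finite_subset_image)
  obtain y0 where "y0 \<in> Y"
    using assms(3) by blast
  have closed: "X closure_of H y = H y" if "y \<in> Y" for y
    using open_U[OF that] by (simp add: H_def K_def closure_of_eq closedin_diff)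
  have "\<not> generalized_KKM Y T H"
  proof
    assume "generalized_KKM Y T H"
    moreover have "correspondence Y (topspace X) H"
      using closure_of_subset_topspace[of X] by (auto simp: correspondence_def H_def K_def)
    ultimately have "finite_intersection_property ((\<lambda>y. X closure_of H y) ` Y)"
      using assms(1) by (simp add: KKM_def)
    \<comment> \<open>Adding \<open>y0\<close> keeps the subfamily nonempty: if \<open>K\<close> is empty, then \<open>F\<close> may be empty too.\<close>
    moreover have "(\<lambda>y. X closure_of H y) ` insert y0 F \<subseteq> (\<lambda>y. X closure_of H y) ` Y"
      using F(2) \<open>y0 \<in> Y\<close> by blast
    ultimately have "\<Inter>((\<lambda>y. X closure_of H y) ` insert y0 F) \<noteq> {}"
      using F(1) unfolding finite_intersection_property_def
      by (meson finite_imageI finite_insert image_is_empty insert_not_empty)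
    then obtain x where "\<And>y. y \<in> insert y0 F \<Longrightarrow> x \<in> H y"
      using closed F(2) \<open>y0 \<in> Y\<close> by fastforce
    then show False
      using F(3) by (auto simp: H_def)
  qed
  then obtain B where B: "finite B" "B \<subseteq> Y"
      "\<not> corr_image T (convex hull B) \<subseteq> corr_image H B"
    by (auto simp: generalized_KKM_def)
  then obtain y x where "y \<in> convex hull B" "x \<in> T y" "\<And>b. b \<in> B \<Longrightarrow> x \<notin> H b"
    unfolding corr_image_def by blast
  then show thesis
    using that B(1,2) unfolding H_def K_def by blast
qed

theorem theorem4:
  fixes X :: "'x topology"
    and Y :: "'y::topological_real_vector set"
    and T :: "'y \<Rightarrow> 'x set"
    and P :: "'x \<Rightarrow> 'y set"
  assumes "topspace X \<noteq> {}"
    and "convex Y"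
    and "T \<in> KKM Y X"
    and "compact_correspondence Y X T"
    and "correspondence (topspace X) Y P"
    and "topspace X = (\<Union>y\<in>Y. X interior_of lower_inverse (topspace X) P y)"
  shows "\<exists>(n::nat) ys ystar xstar.
           n \<ge> 2 \<and> (\<forall>i\<in>{1..n}. ys i \<in> Y) \<and>
           ystar \<in> convex hull (ys ` {1..n}) \<and> xstar \<in> T ystar \<and>
           (\<forall>i\<in>{1..n}. ys i \<in> P xstar)"
proof -
  let ?U = "\<lambda>y. X interior_of lower_inverse (topspace X) P y"
  let ?K = "X closure_of corr_image T Y"
  have "Y \<noteq> {}"
    using assms(1,6) by blast
  moreover have "?K \<subseteq> (\<Union>y\<in>Y. ?U y)"
    using closure_of_subset_topspace[of X] assms(6) by blast
  ultimately obtain B y x where B: "finite B" "B \<subseteq> Y" "y \<in> convex hull B" "x \<in> T y"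
    and avoid: "\<And>b. b \<in> B \<Longrightarrow> x \<notin> ?K - ?U b"
    using KKM_open_cover[OF assms(3,4), of ?U] openin_interior_of by metis
  have "convex hull B \<subseteq> Y"
    using assms(2) B(2) by (rule hull_minimal[rotated])
  then have "x \<in> corr_image T Y"
    using B(3,4) by (auto simp: corr_image_def)
  moreover have "corr_image T Y \<subseteq> topspace X"
    using assms(3) by (auto simp: KKM_def correspondence_def corr_image_def)
  ultimately have "x \<in> ?K"
    using closure_of_subset by blast
  then have in_P: "b \<in> P x" if "b \<in> B" for b
    using avoid[OF that] interior_of_subset[of X "lower_inverse (topspace X) P b"]
    by (auto simp: lower_inverse_def)
  have "B \<noteq> {}"
    using B(3) by auto
  then obtain n :: nat and ys where ys: "n \<ge> 2" "ys ` {1..n} = B"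
    using finite_nonempty_enumeration_ge_2[OF B(1)] by metis
  have "\<forall>i\<in>{1..n}. ys i \<in> B"
    using ys(2) by blast
  then have "n \<ge> 2 \<and> (\<forall>i\<in>{1..n}. ys i \<in> Y) \<and> y \<in> convex hull (ys ` {1..n}) \<and> x \<in> T y \<and>
      (\<forall>i\<in>{1..n}. ys i \<in> P x)"
    using ys B in_P by auto
  then show ?thesis
    by blast
qed

end
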